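(* Let $N\ge5$ be an integer and $\alpha_2,\beta_2,\gamma_2,\delta_2,\mu_2$ real constants. If $u_N(x)=\sum_{k=0}^{N-5}a_kJ_{k+5}^{(-3,-2)}(x)$ is the dual Petrov-Galerkin approximation to $$-u^{(5)}+\alpha_2u^{(4)}+\beta_2u^{(3)}-\gamma_2u^{(2)}-\delta_2u^{(1)}+\mu_2u=f\ \text{ on }(-1,1),\qquad u(\pm1)=u^{(1)}(\pm1)=u^{(2)}(1)=0,$$ then the expansion coefficients $\mathbf a=(a_0,\dots,a_{N-5})^T$ satisfy the matrix system $$(B_2+\alpha_2G_4+\beta_2G_3+\gamma_2G_2+\delta_2G_1+\mu_2G_0)\,\mathbf a=\mathbf f^*,$$ where $\mathbf f^*=(f_0^*,\dots,f_{N-5}^* )^T$, $$f_k^*=\frac{(k+1)(k+2)(k+3)(k+4)(k+5)}{128}\int_{-1}^1(1-x^2)^2(1+x)f(x)R_k^{(2,3)}(x)\,dx,$$ and, with $r_k=3(k+1)(k+2)(k+4)(k+5)$, the nonzero elements of $B_2=(b^2_{kj})$ and $G_i=(g^{i,2}_{kj})$, $0\le i\le4$ (rows $k$, columns $j$, $0\le k,j\le N-5$) are the following (for all $k\ge0$ such that the row and column indices lie in $\{0,\dots,N-5\}$), all other entries being zero: $$b^2_{kk}=r_k;$$ $$g^{4,2}_{kk}=\frac{r_k}{2(k+\frac52)_2},\quad g^{4,2}_{k,k+1}=\frac{3(k+1)_3(k+5)}{2k+7},\quad g^{4,2}_{k+1,k}=\frac{-3(k+2)_5}{(k+3)(2k+7)};$$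 $$g^{3,2}_{kk}=\frac{r_k}{2(k+\frac52)_2},\quad g^{3,2}_{k,k+1}=\frac{-3(k+1)_3(k+5)}{2(k+\frac52)_3},\quad g^{3,2}_{k,k+2}=\frac{-3(k+1)_4}{4(k+\frac72)_2},$$ $$g^{3,2}_{k+1,k}=\frac{3(k+2)(k+4)_3}{2(k+\frac52)_3},\quad g^{3,2}_{k+2,k}=\frac{-3(k+4)_4}{4(k+\frac72)_2};$$ $$g^{2,2}_{kk}=\frac{3r_k}{4(k+\frac32)_4},\quad g^{2,2}_{k,k+1}=\frac{9(k+1)_3(k+5)}{8(k+\frac52)_3},\quad g^{2,2}_{k,k+2}=\frac{-9(k+1)_4}{8(k+\frac52)_4},\quad g^{2,2}_{k,k+3}=\frac{-3(k+1)_5}{8(k+6)(k+\frac72)_3},$$ $$g^{2,2}_{k+1,k}=\frac{-9(k+2)(k+4)_3}{8(k+\frac52)_3},\quad g^{2,2}_{k+2,k}=\frac{-9(k+4)_4}{8(k+\frac52)_4},\quad g^{2,2}_{k+3,k}=\frac{3(k+4)_5}{8(k+3)(k+\frac72)_3};$$ $$g^{1,2}_{kk}=\frac{3r_k}{8(k+\frac32)_4},\quad g^{1,2}_{k,k+1}=\frac{-9(k+1)_3(k+5)}{4(k+\frac32)_5},\quad g^{1,2}_{k,k+2}=\frac{-3(k+1)_4}{4(k+\frac52)_4},$$ $$g^{1,2}_{k,k+3}=\frac{3(k+1)_5}{4(k+6)(k+\frac52)_5},\quad g^{1,2}_{k,k+4}=\frac{3(k+1)_5}{16(k+7)(k+\frac72)_4},\quad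 g^{1,2}_{k+1,k}=\frac{9(k+2)(k+4)_3}{4(k+\frac32)_5},$$ $$g^{1,2}_{k+2,k}=\frac{-3(k+4)_4}{4(k+\frac52)_4},\quad g^{1,2}_{k+3,k}=\frac{-3(k+4)_5}{4(k+3)(k+\frac52)_5},\quad g^{1,2}_{k+4,k}=\frac{3(k+5)_5}{16(k+3)(k+\frac72)_4};$$ $$g^{0,2}_{kk}=\frac{15r_k}{16(k+\frac12)_6},\quad g^{0,2}_{k,k+1}=\frac{15(k+1)_3(k+5)}{16(k+\frac32)_5},\quad g^{0,2}_{k,k+2}=\frac{-15(k+1)_4}{8(k+\frac32)_6},$$ $$g^{0,2}_{k,k+3}=\frac{-15(k+1)_5}{32(k+6)(k+\frac52)_5},\quad g^{0,2}_{k,k+4}=\frac{15(k+1)_5}{32(k+7)(k+\frac52)_6},\quad g^{0,2}_{k,k+5}=\frac{3(k+1)_5}{32(k+8)(k+\frac72)_5},$$ $$g^{0,2}_{k+1,k}=\frac{-15(k+2)(k+4)_3}{16(k+\frac32)_5},\quad g^{0,2}_{k+2,k}=\frac{-15(k+4)_4}{8(k+\frac32)_6},\quad g^{0,2}_{k+3,k}=\frac{15(k+4)_5}{32(k+3)(k+\frac52)_5},$$ $$g^{0,2}_{k+4,k}=\frac{15(k+5)_5}{32(k+3)(k+\frac52)_6},\quad g^{0,2}_{k+5,k}=\frac{-3(k+6)_5}{32(k+3)(k+\frac72)_5}.$$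
   Context: $D=d/dx$, and $(a)_m=a(a+1)\cdots(a+m-1)$ is the Pochhammer symbol. For $\alpha,\beta>-1$, $R_n^{(\alpha,\beta)}(x)=P_n^{(\alpha,\beta)}(x)/P_n^{(\alpha,\beta)}(1)$ is the Jacobi polynomial of degree $n$ normalized to equal $1$ at $x=1$; explicitly $$R_n^{(\alpha,\beta)}(x)=\left(-\tfrac12\right)^n\frac{\Gamma(\alpha+1)}{\Gamma(n+\alpha+1)}(1-x)^{-\alpha}(1+x)^{-\beta}D^n\left[(1-x)^{\alpha+n}(1+x)^{\beta+n}\right].$$ The generalized Jacobi polynomials used are $J_{k+5}^{(-3,-2)}(x)=(1-x^2)^2(1-x)R_k^{(3,2)}(x)$ and $J_{k+5}^{(-2,-3)}(x)=(1-x^2)^2(1+x)R_k^{(2,3)}(x)$, $k\ge0$. Let $V_N=\mathrm{span}\{J_{k+5}^{(-3,-2)}:0\le k\le N-5\}$ (the polynomials of degree at most $N$ with $u(\pm1)=u'(\pm1)=u''(1)=0$) and $V_N^*=\mathrm{span}\{J_{k+5}^{(-2,-3)}:0\le k\le N-5\}$ (the polynomials of degree at most $N$ with $v(\pm1)=v'(\pm1)=v''(-1)=0$). With $(u,v)=\int_{-1}^1uv\,dx$ and $f$ a given function for which the integrals $(f,v)$, $v\in V_N^*$, are defined, a dual Petrov-Galerkin approximation is $u_N\in V_N$ such that $$-(D^5u_N,v)+\alpha_2(D^4u_N,v)+\beta_2(D^3u_N,v)-\gamma_2(D^2u_N,v)-\delta_2(Du_N,v)+\mu_2(u_N,v)=(f,v)\quad\forall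 v\in V_N^*.$$ *)

theory Defs
  imports
    "HOL-Analysis.Analysis"
    "HOL-Computational_Algebra.Polynomial"
    "Jordan_Normal_Form.Matrix"
begin

definition rodrigues :: "real \<Rightarrow> real \<Rightarrow> nat \<Rightarrow> real \<Rightarrow> real" where
  "rodrigues \<alpha> \<beta> n x =
     (- 1 / 2) ^ n * (Gamma (\<alpha> + 1) / Gamma (real n + \<alpha> + 1))
     * (1 - x) powr (- \<alpha>) * (1 + x) powr (- \<beta>)
     * (deriv ^^ n) (\<lambda>t. (1 - t) powr (\<alpha> + real n) * (1 + t) powr (\<beta> + real n)) x"

text \<open>The Rodrigues expression is meaningful on the open interval only, so the Jacobi
  polynomial is the unique polynomial agreeing with it there; existence is shown in
  \<open>poly_jacobiR\<close> and the normalisation in \<open>poly_jacobiR_1\<close> below.\<close>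

definition jacobiR :: "real \<Rightarrow> real \<Rightarrow> nat \<Rightarrow> real poly" where
  "jacobiR \<alpha> \<beta> n = (THE p. \<forall>x\<in>{-1<..<1}. poly p x = rodrigues \<alpha> \<beta> n x)"

fun rodrigues_poly :: "real \<Rightarrow> real \<Rightarrow> nat \<Rightarrow> real poly" where
  "rodrigues_poly a b 0 = 1"
| "rodrigues_poly a b (Suc m) =
     (Polynomial.smult (- (a - real m)) [:1, 1:] + Polynomial.smult (b - real m) [:1, -1:]) * rodrigues_poly a b m
     + [:1, 0, -1:] * pderiv (rodrigues_poly a b m)"

lemma deriv_iterate_weight:
  assumes "x \<in> {-1<..<1}"
  shows "(deriv ^^ m) (\<lambda>t::real. (1 - t) powr a * (1 + t) powr b) x
       = (1 - x) powr (a - real m) * (1 + x) powr (b - real m) * poly (rodrigues_poly a b m) x"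
  using assms
proof (induction m arbitrary: x)
  case 0
  then show ?case by simp
next
  case (Suc m)
  let ?F = "(deriv ^^ m) (\<lambda>t::real. (1 - t) powr a * (1 + t) powr b)"
  let ?q = "rodrigues_poly a b m"
  let ?G = "\<lambda>t. (1 - t) powr (a - real m) * (1 + t) powr (b - real m) * poly ?q t"
  define A where "A = (1 - x) powr (a - real m - 1)"
  define B where "B = (1 + x) powr (b - real m - 1)"
  have pos: "1 - x > 0" "1 + x > 0" using Suc.prems by auto
  have A: "(1 - x) powr (a - real m) = (1 - x) * A"
    unfolding A_def using pos by (simp add: powr_diff)
  have B: "(1 + x) powr (b - real m) = (1 + x) * B"
    unfolding B_def using pos by (simp add: powr_diff)
  have "eventually (\<lambda>t. t \<in> {-1<..<1}) (nhds x)"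
    using Suc.prems by (intro eventually_nhds_in_open) auto
  then have "eventually (\<lambda>t. ?F t = ?G t) (nhds x)"
    by eventually_elim (use Suc.IH in auto)
  then have eq: "deriv ?F x = deriv ?G x"
    by (rule deriv_cong_ev) simp
  have DA: "((\<lambda>t. (1 - t) powr (a - real m)) has_field_derivative - (a - real m) * A) (at x)"
    using pos by (auto intro!: derivative_eq_intros simp: A_def left_diff_distrib)
  have DB: "((\<lambda>t. (1 + t) powr (b - real m)) has_field_derivative (b - real m) * B) (at x)"
    using pos by (auto intro!: derivative_eq_intros simp: B_def)
  have "(?G has_field_derivative (A * B * poly (rodrigues_poly a b (Suc m)) x)) (at x)"
    by (rule DERIV_cong[OF DERIV_mult[OF DERIV_mult[OF DA DB] poly_DERIV]])
       (simp add: A B algebra_simps)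
  then have "deriv ?G x = A * B * poly (rodrigues_poly a b (Suc m)) x"
    by (rule DERIV_imp_deriv)
  with eq show ?case by (simp add: A_def B_def diff_diff_eq add.commute)
qed

lemma poly_rodrigues_poly_1:
  "poly (rodrigues_poly a b m) 1 = (-2) ^ m * (\<Prod>i<m. a - real i)"
  by (induction m) (auto simp: algebra_simps)

lemma poly_eq_on_Ioo:
  fixes p q :: "real poly"
  assumes "\<forall>x\<in>{-1<..<1}. poly p x = h x" "\<forall>x\<in>{-1<..<1}. poly q x = h x"
  shows "p = q"
proof (rule ccontr)
  assume "p \<noteq> q"
  then have "finite {x. poly (p - q) x = 0}" by (intro poly_roots_finite) auto
  moreover have "{-1<..<1} \<subseteq> {x. poly (p - q) x = 0}" using assms by auto
  ultimately have "finite {-1<..<1::real}" by (rule finite_subset[rotated])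
  then show False by (simp add: infinite_Ioo)
qed

lemma poly_rodrigues_poly:
  assumes "x \<in> {-1<..<1}"
  shows "poly (Polynomial.smult ((- 1 / 2) ^ n * (Gamma (\<alpha> + 1) / Gamma (real n + \<alpha> + 1)))
           (rodrigues_poly (\<alpha> + real n) (\<beta> + real n) n)) x = rodrigues \<alpha> \<beta> n x"
proof -
  from assms have "(1 - x) powr (- \<alpha>) * (1 - x) powr \<alpha> = 1"
            "(1 + x) powr (- \<beta>) * (1 + x) powr \<beta> = 1"
    by (auto simp flip: powr_add)
  then have "(1 - x) powr (- \<alpha>) * ((1 + x) powr (- \<beta>) *
       ((1 - x) powr \<alpha> * ((1 + x) powr \<beta> * c))) = c" for c
    by (metis (no_types, opaque_lifting) mult.assoc mult.left_commute mult_1)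
  then show ?thesis
    unfolding rodrigues_def deriv_iterate_weight[OF assms] by (simp add: mult.assoc)
qed

lemma jacobiR_eq_rodrigues_poly:
  "jacobiR \<alpha> \<beta> n =
     Polynomial.smult ((- 1 / 2) ^ n * (Gamma (\<alpha> + 1) / Gamma (real n + \<alpha> + 1)))
       (rodrigues_poly (\<alpha> + real n) (\<beta> + real n) n)"
  unfolding jacobiR_def
  by (rule the_equality) (blast intro: poly_rodrigues_poly poly_eq_on_Ioo)+

lemma poly_jacobiR:
  assumes "x \<in> {-1<..<1}"
  shows "poly (jacobiR \<alpha> \<beta> n) x = rodrigues \<alpha> \<beta> n x"
  unfolding jacobiR_eq_rodrigues_poly by (rule poly_rodrigues_poly[OF assms])

lemma poly_jacobiR_1:
  assumes "\<alpha> > -1"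
  shows "poly (jacobiR \<alpha> \<beta> n) 1 = 1"
proof -
  have "Gamma (real n + \<alpha> + 1) = pochhammer (\<alpha> + 1) n * Gamma (\<alpha> + 1)"
  proof -
    have "\<alpha> + 1 \<notin> \<int>\<^sub>\<le>\<^sub>0" using assms by (auto elim!: nonpos_Ints_cases)
    moreover have "Gamma (\<alpha> + 1) > 0" using assms by (intro Gamma_real_pos) auto
    ultimately show ?thesis by (simp add: pochhammer_Gamma add_ac)
  qed
  moreover have "Gamma (\<alpha> + 1) > 0" "pochhammer (\<alpha> + 1) n > 0"
    using assms by (auto intro: Gamma_real_pos pochhammer_pos)
  moreover have "(\<Prod>i<n. \<alpha> + real n - real i) = pochhammer (\<alpha> + 1) n"
    unfolding pochhammer_prod
    by (rule prod.reindex_bij_witness[of _ "\<lambda>i. n - 1 - i" "\<lambda>i. n - 1 - i"])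
       (auto simp: of_nat_diff)
  moreover have "(- 1 / 2 :: real) ^ n * (- 2) ^ n = 1"
    by (simp flip: power_mult_distrib)
  ultimately show ?thesis
    by (simp add: jacobiR_eq_rodrigues_poly poly_rodrigues_poly_1)
qed

text \<open>\<open>J32 n\<close> and \<open>J23 n\<close> are the generalised Jacobi polynomials with parameters
  $(-3,-2)$ and $(-2,-3)$ of degree \<open>n\<close>; they are only meant for \<open>n \<ge> 5\<close>.\<close>

definition J32 :: "nat \<Rightarrow> real poly" where
  "J32 n = [:1, 0, -1:] ^ 2 * [:1, -1:] * jacobiR 3 2 (n - 5)"

definition J23 :: "nat \<Rightarrow> real poly" where
  "J23 n = [:1, 0, -1:] ^ 2 * [:1, 1:] * jacobiR 2 3 (n - 5)"

definition trial_space :: "nat \<Rightarrow> real poly set" where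
  "trial_space N = Modules.module.span Polynomial.smult {J32 (k + 5) | k. k \<le> N - 5}"

definition test_space :: "nat \<Rightarrow> real poly set" where
  "test_space N = Modules.module.span Polynomial.smult {J23 (k + 5) | k. k \<le> N - 5}"

text \<open>The Henstock--Kurzweil integral extends the Lebesgue integral.\<close>

definition ip :: "(real \<Rightarrow> real) \<Rightarrow> (real \<Rightarrow> real) \<Rightarrow> real" where
  "ip u v = integral {-1..1} (\<lambda>x. u x * v x)"

definition dual_petrov_galerkin ::
  "nat \<Rightarrow> real \<Rightarrow> real \<Rightarrow> real \<Rightarrow> real \<Rightarrow> real \<Rightarrow> (real \<Rightarrow> real) \<Rightarrow> real poly \<Rightarrow> bool" where
  "dual_petrov_galerkin N \<alpha>\<^sub>2 \<beta>\<^sub>2 \<gamma>\<^sub>2 \<delta>\<^sub>2 \<mu>\<^sub>2 f u \<longleftrightarrow>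
     u \<in> trial_space N \<and>
     (\<forall>v\<in>test_space N.
        - ip (poly ((pderiv ^^ 5) u)) (poly v)
        + \<alpha>\<^sub>2 * ip (poly ((pderiv ^^ 4) u)) (poly v)
        + \<beta>\<^sub>2 * ip (poly ((pderiv ^^ 3) u)) (poly v)
        - \<gamma>\<^sub>2 * ip (poly ((pderiv ^^ 2) u)) (poly v)
        - \<delta>\<^sub>2 * ip (poly (pderiv u)) (poly v)
        + \<mu>\<^sub>2 * ip (poly u) (poly v)
        = ip f (poly v))"

definition r :: "nat \<Rightarrow> real" where
  "r k = 3 * (real k + 1) * (real k + 2) * (real k + 4) * (real k + 5)"

text \<open>In the entries below the first argument is the row and the second the column; an entry
  under the diagonal is parametrised by its column.\<close>

definition b2 :: "nat \<Rightarrow> nat \<Rightarrow> real" where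
  "b2 k j = (if j = k then r k else 0)"

definition g4 :: "nat \<Rightarrow> nat \<Rightarrow> real" where
  "g4 k j =
    (if j = k then r k / (2 * pochhammer (real k + 5/2) 2)
     else if j = k + 1 then 3 * pochhammer (real k + 1) 3 * (real k + 5) / (2 * real k + 7)
     else if k = j + 1 then - 3 * pochhammer (real j + 2) 5 / ((real j + 3) * (2 * real j + 7))
     else 0)"

definition g3 :: "nat \<Rightarrow> nat \<Rightarrow> real" where
  "g3 k j =
    (if j = k then r k / (2 * pochhammer (real k + 5/2) 2)
     else if j = k + 1 then
       - 3 * pochhammer (real k + 1) 3 * (real k + 5) / (2 * pochhammer (real k + 5/2) 3)
     else if j = k + 2 then
       - 3 * pochhammer (real k + 1) 4 / (4 * pochhammer (real k + 7/2) 2)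
     else if k = j + 1 then
       3 * (real j + 2) * pochhammer (real j + 4) 3 / (2 * pochhammer (real j + 5/2) 3)
     else if k = j + 2 then
       - 3 * pochhammer (real j + 4) 4 / (4 * pochhammer (real j + 7/2) 2)
     else 0)"

definition g2 :: "nat \<Rightarrow> nat \<Rightarrow> real" where
  "g2 k j =
    (if j = k then 3 * r k / (4 * pochhammer (real k + 3/2) 4)
     else if j = k + 1 then
       9 * pochhammer (real k + 1) 3 * (real k + 5) / (8 * pochhammer (real k + 5/2) 3)
     else if j = k + 2 then
       - 9 * pochhammer (real k + 1) 4 / (8 * pochhammer (real k + 5/2) 4)
     else if j = k + 3 then
       - 3 * pochhammer (real k + 1) 5 / (8 * (real k + 6) * pochhammer (real k + 7/2) 3)
     else if k = j + 1 then
       - 9 * (real j + 2) * pochhammer (real j + 4) 3 / (8 * pochhammer (real j + 5/2) 3)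
     else if k = j + 2 then
       - 9 * pochhammer (real j + 4) 4 / (8 * pochhammer (real j + 5/2) 4)
     else if k = j + 3 then
       3 * pochhammer (real j + 4) 5 / (8 * (real j + 3) * pochhammer (real j + 7/2) 3)
     else 0)"

definition g1 :: "nat \<Rightarrow> nat \<Rightarrow> real" where
  "g1 k j =
    (if j = k then 3 * r k / (8 * pochhammer (real k + 3/2) 4)
     else if j = k + 1 then
       - 9 * pochhammer (real k + 1) 3 * (real k + 5) / (4 * pochhammer (real k + 3/2) 5)
     else if j = k + 2 then
       - 3 * pochhammer (real k + 1) 4 / (4 * pochhammer (real k + 5/2) 4)
     else if j = k + 3 then
       3 * pochhammer (real k + 1) 5 / (4 * (real k + 6) * pochhammer (real k + 5/2) 5)
     else if j = k + 4 then
       3 * pochhammer (real k + 1) 5 / (16 * (real k + 7) * pochhammer (real k + 7/2) 4)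
     else if k = j + 1 then
       9 * (real j + 2) * pochhammer (real j + 4) 3 / (4 * pochhammer (real j + 3/2) 5)
     else if k = j + 2 then
       - 3 * pochhammer (real j + 4) 4 / (4 * pochhammer (real j + 5/2) 4)
     else if k = j + 3 then
       - 3 * pochhammer (real j + 4) 5 / (4 * (real j + 3) * pochhammer (real j + 5/2) 5)
     else if k = j + 4 then
       3 * pochhammer (real j + 5) 5 / (16 * (real j + 3) * pochhammer (real j + 7/2) 4)
     else 0)"

definition g0 :: "nat \<Rightarrow> nat \<Rightarrow> real" where
  "g0 k j =
    (if j = k then 15 * r k / (16 * pochhammer (real k + 1/2) 6)
     else if j = k + 1 then
       15 * pochhammer (real k + 1) 3 * (real k + 5) / (16 * pochhammer (real k + 3/2) 5)
     else if j = k + 2 then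
       - 15 * pochhammer (real k + 1) 4 / (8 * pochhammer (real k + 3/2) 6)
     else if j = k + 3 then
       - 15 * pochhammer (real k + 1) 5 / (32 * (real k + 6) * pochhammer (real k + 5/2) 5)
     else if j = k + 4 then
       15 * pochhammer (real k + 1) 5 / (32 * (real k + 7) * pochhammer (real k + 5/2) 6)
     else if j = k + 5 then
       3 * pochhammer (real k + 1) 5 / (32 * (real k + 8) * pochhammer (real k + 7/2) 5)
     else if k = j + 1 then
       - 15 * (real j + 2) * pochhammer (real j + 4) 3 / (16 * pochhammer (real j + 3/2) 5)
     else if k = j + 2 then
       - 15 * pochhammer (real j + 4) 4 / (8 * pochhammer (real j + 3/2) 6)
     else if k = j + 3 then
       15 * pochhammer (real j + 4) 5 / (32 * (real j + 3) * pochhammer (real j + 5/2) 5)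
     else if k = j + 4 then
       15 * pochhammer (real j + 5) 5 / (32 * (real j + 3) * pochhammer (real j + 5/2) 6)
     else if k = j + 5 then
       - 3 * pochhammer (real j + 6) 5 / (32 * (real j + 3) * pochhammer (real j + 7/2) 5)
     else 0)"

text \<open>\<open>sqmat N g\<close> has rows and columns $0,\ldots,N-5$, hence size $N-4$ for $N \ge 5$.\<close>

definition sqmat :: "nat \<Rightarrow> (nat \<Rightarrow> nat \<Rightarrow> real) \<Rightarrow> real Matrix.mat" where
  "sqmat N g = Matrix.mat (N - 4) (N - 4) (\<lambda>(k, j). g k j)"

definition fstar :: "(real \<Rightarrow> real) \<Rightarrow> nat \<Rightarrow> real" where
  "fstar f k =
     (real k + 1) * (real k + 2) * (real k + 3) * (real k + 4) * (real k + 5) / 128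
     * integral {-1..1} (\<lambda>x. (1 - x\<^sup>2)\<^sup>2 * (1 + x) * f x * poly (jacobiR 2 3 k) x)"

end

theory Submission
  imports Defs
begin

text \<open>Write $B_j = D^j[(1-x)^{j+3}(1+x)^{j+2}]$ and $A_k = D^k[(1-x)^{k+2}(1+x)^{k+3}]$; by Rodrigues'
  formula these are multiples of $J_{j+5}^{(-3,-2)}$ and $J_{k+5}^{(-2,-3)}$, so every matrix entry is a
  multiple of $\int D^iB_j\,A_k$. For $i = 5$ the matrix is diagonal by orthogonality. For
  $k \ge 1$, $A_k$ is the derivative of a combination of $A_{k-1}, A_k, A_{k+1}$, so one integration by
  parts expresses row $k$ of the matrix for $i$ through rows $k-1, k, k+1$ of the matrix for
  $i + 1$. The substitution $x \mapsto -x$ exchanges $A$ and $B$ and relates the entries $(k, j)$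
  and $(j, k)$. The closed forms obey the same recurrence and the same symmetry; only the corner entry
  $(0, 0)$, which the recurrence does not reach, has to be integrated explicitly.\<close>

section \<open>Integration by parts for polynomials\<close>

definition poly_int :: "real poly \<Rightarrow> real" where
  "poly_int p = integral {-1..1} (poly p)"

lemma poly_integrable_on: "poly (p :: real poly) integrable_on {a..b}"
  by (intro integrable_continuous_real continuous_intros)

lemma poly_int_add: "poly_int (p + q) = poly_int p + poly_int q"
proof -
  have "poly (p + q) = (\<lambda>x. poly p x + poly q x)"
    by (rule ext) simp
  then show ?thesis
    by (simp only: poly_int_def integral_add poly_integrable_on)
qed

lemma poly_int_smult: "poly_int (Polynomial.smult c p) = c * poly_int p"
proof -
  have "poly (Polynomial.smult c p) = (\<lambda>x. c * poly p x)"
    by (rule ext) simp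
  then show ?thesis
    by (simp only: poly_int_def integral_mult_right)
qed

lemma poly_int_0: "poly_int 0 = 0"
  using poly_int_smult[of 0 0] by simp

lemma poly_int_sum: "poly_int (\<Sum>i\<in>A. p i) = (\<Sum>i\<in>A. poly_int (p i))"
  by (induction A rule: infinite_finite_induct) (simp_all add: poly_int_add poly_int_0)

lemma poly_int_pderiv: "poly_int (pderiv p) = poly p 1 - poly p (-1)"
proof -
  have "(poly (pderiv p) has_integral (poly p 1 - poly p (-1))) {-1..1}"
    by (intro fundamental_theorem_of_calculus)
      (auto simp: has_real_derivative_iff_has_vector_derivative[symmetric]
        intro: has_field_derivative_at_within poly_DERIV)
  then show ?thesis
    by (simp add: poly_int_def integral_unique)
qed

lemma poly_int_by_parts:
  assumes "poly (p * q) 1 = 0" "poly (p * q) (-1) = 0"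
  shows "poly_int (pderiv p * q) = - poly_int (p * pderiv q)"
proof -
  have "poly_int (pderiv (p * q)) = 0"
    using assms by (simp only: poly_int_pderiv poly_mult)
  then show ?thesis
    by (simp add: pderiv_mult poly_int_add mult.commute)
qed

text \<open>One derivative is moved at a time, with \<open>q\<close> generalised to
  \<open>pderiv q\<close>. Vanishing is required only of products of derivatives, so the zeros at an
  endpoint may be shared between \<open>p\<close> and \<open>q\<close>.\<close>

lemma poly_int_by_parts_funpow:
  assumes "\<And>a b x. a + b < n \<Longrightarrow> x \<in> {1, -1} \<Longrightarrow>
    poly ((pderiv ^^ a) p) x * poly ((pderiv ^^ b) q) x = 0"
  shows "poly_int ((pderiv ^^ n) p * q) = (-1) ^ n * poly_int (p * (pderiv ^^ n) q)"
  using assms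
proof (induction n arbitrary: q)
  case 0
  then show ?case by simp
next
  case (Suc n)
  have "poly_int ((pderiv ^^ Suc n) p * q) = - poly_int ((pderiv ^^ n) p * pderiv q)"
    using Suc.prems[of n 0] by (simp add: poly_int_by_parts)
  also have "poly_int ((pderiv ^^ n) p * pderiv q) = (-1) ^ n * poly_int (p * (pderiv ^^ n) (pderiv q))"
  proof (rule Suc.IH)
    fix a b and x :: real
    assume "a + b < n" "x \<in> {1, -1}"
    then show "poly ((pderiv ^^ a) p) x * poly ((pderiv ^^ b) (pderiv q)) x = 0"
      using Suc.prems[of a "Suc b" x] by (simp add: funpow_swap1)
  qed
  finally show ?case
    by (simp add: funpow_swap1)
qed

lemma poly_int_reflect: "poly_int (pcompose p [:0, -1:]) = poly_int p"
proof -
  have "poly (pcompose p [:0, -1:]) = (\<lambda>x. poly p (- x))"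
    by (rule ext) (simp add: poly_pcompose)
  then show ?thesis
    using Henstock_Kurzweil_Integration.integral_reflect_real[of 1 "-1" "poly p"] by (simp add: poly_int_def)
qed

lemma higher_pderiv_reflect:
  fixes p :: "real poly"
  shows "pcompose ((pderiv ^^ n) p) [:0, -1:] =
    Polynomial.smult ((-1) ^ n) ((pderiv ^^ n) (pcompose p [:0, -1:]))"
proof (induction n)
  case 0
  then show ?case by simp
next
  case (Suc n)
  have "pcompose (pderiv q) [:0, -1:] = - pderiv (pcompose q [:0, -1:])" for q :: "real poly"
    by (simp add: pderiv_pcompose pderiv_pCons)
  then show ?case
    using Suc.IH by (simp add: pderiv_smult)
qed

text \<open>By the product rule each derivative costs at most one factor \<open>d\<close>. Truncated
  subtraction makes the claim trivial once \<open>m\<close> reaches \<open>k\<close>.\<close>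

lemma power_dvd_higher_pderiv:
  fixes p :: "real poly"
  assumes "d ^ k dvd p"
  shows "d ^ (k - m) dvd (pderiv ^^ m) p"
proof (induction m)
  case 0
  then show ?case using assms by simp
next
  case (Suc m)
  show ?case
  proof (cases "k - m")
    case 0
    then show ?thesis by simp
  next
    case (Suc l)
    with Suc.IH obtain s where "(pderiv ^^ m) p = d ^ Suc l * s"
      by (auto simp: dvd_def)
    then have "(pderiv ^^ Suc m) p =
      d ^ l * (Polynomial.smult (of_nat (Suc l)) (pderiv d) * s + d * pderiv s)"
      by (simp add: pderiv_mult pderiv_power_Suc algebra_simps del: power_Suc of_nat_Suc)
        (simp add: algebra_simps)
    moreover have "k - Suc m = l"
      using Suc by simp
    ultimately show ?thesis by simp
  qed
qed

lemma poly_higher_pderiv_eq_0: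
  fixes p :: "real poly"
  assumes "d ^ k dvd p" "m < k" "poly d x = 0"
  shows "poly ((pderiv ^^ m) p) x = 0"
proof -
  have "d ^ 1 dvd d ^ (k - m)"
    using assms(2) by (intro le_imp_power_dvd) simp
  then have "d dvd (pderiv ^^ m) p"
    using power_dvd_higher_pderiv[OF assms(1)] by (metis dvd_trans power_one_right)
  then show ?thesis
    using assms(3) by (auto simp: dvd_def)
qed

text \<open>The Beta integral at integer parameters. Integration by parts trades a factor $1-x$ for
  a factor $1+x$, so the induction on \<open>a\<close> keeps \<open>b\<close> arbitrary and ends at
  a pure power of $1+x$.\<close>

lemma poly_int_weight:
  "poly_int ([:1, -1:] ^ a * [:1, 1:] ^ b) = 2 ^ (a + b + 1) * fact a * fact b / fact (a + b + 1)"
proof (induction a arbitrary: b)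
  case 0
  have "pderiv ([:1, 1:] ^ Suc b :: real poly) = Polynomial.smult (real b + 1) ([:1, 1:] ^ b)"
    by (simp add: pderiv_power_Suc pderiv_pCons add.commute del: power_Suc)
  then have "(real b + 1) * poly_int ([:1, 1:] ^ b) = 2 ^ Suc b"
    using poly_int_pderiv[of "[:1, 1:] ^ Suc b"] by (simp add: poly_int_smult)
  then have "poly_int ([:1, 1:] ^ b) = 2 ^ Suc b / (real b + 1)"
    by (simp add: eq_divide_eq algebra_simps)
  then show ?case
    by (simp add: add.commute)
next
  case (Suc a)
  have D1: "pderiv ([:1, 1:] ^ Suc b :: real poly) = Polynomial.smult (real b + 1) ([:1, 1:] ^ b)"
    by (simp add: pderiv_power_Suc pderiv_pCons add.commute del: power_Suc)
  have D2: "pderiv ([:1, -1:] ^ Suc a :: real poly) = Polynomial.smult (- (real a + 1)) ([:1, -1:] ^ a)"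
    by (simp add: pderiv_power_Suc pderiv_pCons add.commute del: power_Suc)
  have "poly_int (pderiv ([:1, 1:] ^ Suc b) * [:1, -1:] ^ Suc a) =
      - poly_int ([:1, 1:] ^ Suc b * pderiv ([:1, -1:] ^ Suc a))"
    by (rule poly_int_by_parts) simp_all
  then have "(real b + 1) * poly_int ([:1, -1:] ^ Suc a * [:1, 1:] ^ b) =
      - (- (real a + 1) * poly_int ([:1, -1:] ^ a * [:1, 1:] ^ Suc b))"
    unfolding D1 D2 mult_smult_left mult_smult_right poly_int_smult
    by (metis mult.commute)
  then have "(real b + 1) * poly_int ([:1, -1:] ^ Suc a * [:1, 1:] ^ b) =
      (real a + 1) * poly_int ([:1, -1:] ^ a * [:1, 1:] ^ Suc b)"
    by (simp only: minus_mult_left minus_minus)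
  also have "\<dots> = (real a + 1) * (2 ^ (a + Suc b + 1) * fact a * fact (Suc b) / fact (a + Suc b + 1))"
    unfolding Suc.IH ..
  finally have "poly_int ([:1, -1:] ^ Suc a * [:1, 1:] ^ b) =
      (real a + 1) * (2 ^ (a + Suc b + 1) * fact a * fact (Suc b) / fact (a + Suc b + 1)) / (real b + 1)"
    by (metis nonzero_mult_div_cancel_left of_nat_Suc of_nat_neq_0 add.commute)
  also have "fact (Suc b) = (real b + 1) * fact b"
    by (simp add: add.commute)
  also have "(real a + 1) * (2 ^ (a + Suc b + 1) * fact a * ((real b + 1) * fact b) / fact (a + Suc b + 1))
      / (real b + 1)
    = 2 ^ (Suc a + b + 1) * ((real a + 1) * fact a) * fact b / fact (Suc a + b + 1)"
    by (simp add: divide_simps del: fact_Suc)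
  also have "(real a + 1) * fact a = fact (Suc a)"
    by (simp add: add.commute)
  finally show ?case .
qed

lemma higher_pderiv_const:
  fixes p :: "real poly"
  assumes "Polynomial.degree p = n"
  shows "(pderiv ^^ n) p = [:fact n * Polynomial.lead_coeff p:]"
proof -
  have "Polynomial.degree ((pderiv ^^ n) p) = 0"
    using assms by (simp add: degree_higher_pderiv)
  then have "(pderiv ^^ n) p = [:Polynomial.coeff ((pderiv ^^ n) p) 0:]"
    by (metis degree_0_id)
  then show ?thesis
    using assms by (simp add: coeff_higher_pderiv pochhammer_fact)
qed

section \<open>Rodrigues polynomials and their pairings\<close>

text \<open>\<open>weighted_jacobi 2 3 k\<close> is $A_k$ and \<open>weighted_jacobi 3 2 j\<close>
  is $B_j$. Keeping the derivative form of Rodrigues' formula lets integration by parts act on the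
  weight directly.\<close>

definition weighted_jacobi :: "nat \<Rightarrow> nat \<Rightarrow> nat \<Rightarrow> real poly" where
  "weighted_jacobi a b n = (pderiv ^^ n) ([:1, -1:] ^ (n + a) * [:1, 1:] ^ (n + b))"

text \<open>The polynomial counterpart of \<open>deriv_iterate_weight\<close>: with natural
  exponents of at least \<open>m\<close>, the powers left after \<open>m\<close> derivatives factor
  out, and the cofactor obeys the recursion of \<open>rodrigues_poly\<close>.\<close>

lemma higher_pderiv_weight:
  assumes "m \<le> a" "m \<le> b"
  shows "(pderiv ^^ m) ([:1, -1:] ^ a * [:1, 1:] ^ b) =
    [:1, -1:] ^ (a - m) * [:1, 1:] ^ (b - m) * rodrigues_poly (real a) (real b) m"
  using assms
proof (induction m)
  case 0
  then show ?case by simp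
next
  case (Suc m)
  define i j where "i = a - Suc m" and "j = b - Suc m"
  have ij: "a - m = Suc i" "b - m = Suc j" "real a - real m = real (Suc i)" "real b - real m = real (Suc j)"
    using Suc.prems by (auto simp: i_def j_def)
  define X Y :: "real poly" where "X = [:1, -1:]" and "Y = [:1, 1:]"
  have DX: "pderiv (X ^ Suc i) = Polynomial.smult (- real (Suc i)) (X ^ i)"
    by (simp add: X_def pderiv_power_Suc pderiv_pCons del: power_Suc of_nat_Suc)
  have DY: "pderiv (Y ^ Suc j) = Polynomial.smult (real (Suc j)) (Y ^ j)"
    by (simp add: Y_def pderiv_power_Suc pderiv_pCons del: power_Suc of_nat_Suc)
  let ?q = "rodrigues_poly (real a) (real b) m"
  have XY: "[:1, 0, -1 :: real:] = X * Y"
    by (simp add: X_def Y_def)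
  have "(pderiv ^^ Suc m) (X ^ a * Y ^ b) = pderiv (X ^ Suc i * Y ^ Suc j * ?q)"
    using Suc ij by (simp add: X_def Y_def)
  also have "\<dots> = X ^ i * Y ^ j *
     ((Polynomial.smult (- real (Suc i)) Y + Polynomial.smult (real (Suc j)) X) * ?q + (X * Y) * pderiv ?q)"
    unfolding pderiv_mult DX DY by (simp add: algebra_simps del: of_nat_Suc)
  finally show ?case
    unfolding rodrigues_poly.simps ij XY i_def[symmetric] j_def[symmetric] X_def[symmetric] Y_def[symmetric] .
qed

lemma pcompose_power:
  fixes p q :: "'a::comm_semiring_1 poly"
  shows "pcompose (p ^ n) q = pcompose p q ^ n"
  by (induction n) (simp_all add: pcompose_mult pcompose_1)

lemma weighted_jacobi_reflect:
  "pcompose (weighted_jacobi a b n) [:0, -1:] = Polynomial.smult ((-1) ^ n) (weighted_jacobi b a n)"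
proof -
  have "pcompose ([:1, -1:] ^ (n + a) * [:1, 1:] ^ (n + b)) [:0, -1:] =
      [:1, -1:] ^ (n + b) * [:1, 1 :: real:] ^ (n + a)"
    by (simp add: pcompose_mult pcompose_power pcompose_pCons mult.commute)
  then show ?thesis
    unfolding weighted_jacobi_def higher_pderiv_reflect by simp
qed

lemma weighted_jacobi_Suc:
  "weighted_jacobi 2 3 (n + 1) = pderiv (
      Polynomial.smult (2 * (real n + 3) / (2 * real n + 7)) (weighted_jacobi 2 3 n)
    + Polynomial.smult (2 / ((2 * real n + 7) * (2 * real n + 9))) (weighted_jacobi 2 3 (n + 1))
    - Polynomial.smult (1 / ((2 * real n + 8) * (2 * real n + 9))) (weighted_jacobi 2 3 (n + 2)))"
proof -
  \<comment> \<open>All terms are \<open>n\<close>-th derivatives of \<open>w\<close> times a polynomial of degree at most 2, so it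
    suffices to compare these quadratics.\<close>
  define X Y :: "real poly" where "X = [:1, -1:]" and "Y = [:1, 1:]"
  define w where "w = X ^ (n + 2) * Y ^ (n + 3)"
  \<comment> \<open>\<open>c0\<close>, \<open>c1\<close> and \<open>- c2\<close> are the coordinates
    of $1-x^2$ in the basis \<open>1\<close>, \<open>q1\<close>, \<open>q2\<close> of the
    quadratics. The factor $1-x^2$ arises because the weight differentiated in $A_{n+1}$ is
    \<open>w\<close> times it.\<close>
  define c0 c1 c2 where "c0 = 2 * (real n + 3) / (2 * real n + 7)"
    and "c1 = 2 / ((2 * real n + 7) * (2 * real n + 9))"
    and "c2 = 1 / ((2 * real n + 8) * (2 * real n + 9))"
  define q1 q2 where "q1 = rodrigues_poly (real (n + 3)) (real (n + 4)) 1"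
    and "q2 = rodrigues_poly (real (n + 4)) (real (n + 5)) 2"
  have exps: "n + 1 + 2 = n + 3" "n + 1 + 3 = n + 4" "n + 2 + 2 = n + 4" "n + 2 + 3 = n + 5"
    by simp_all
  have funpow_1: "(pderiv ^^ (n + 1)) p = (pderiv ^^ n) (pderiv p)" for p :: "real poly"
    by (simp add: funpow_swap1)
  have D1: "pderiv (X ^ (n + 3) * Y ^ (n + 4)) = w * q1"
    using higher_pderiv_weight[of 1 "n + 3" "n + 4", folded X_def Y_def q1_def]
    by (simp add: w_def add.commute)
  have D2: "(pderiv ^^ 2) (X ^ (n + 4) * Y ^ (n + 5)) = w * q2"
    using higher_pderiv_weight[of 2 "n + 4" "n + 5", folded X_def Y_def q2_def]
    by (simp add: w_def add.commute)
  have XY: "X * Y = [:c0:] + Polynomial.smult c1 q1 - Polynomial.smult c2 q2"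
  proof -
    have "2 * real n + 7 \<noteq> 0" "2 * real n + 8 \<noteq> 0" "2 * real n + 9 \<noteq> 0"
      by linarith+
    then show ?thesis
      unfolding X_def Y_def q1_def q2_def c0_def c1_def c2_def
      by (simp add: numeral_2_eq_2 pderiv_pCons divide_simps) (simp add: algebra_simps)
  qed
  have "X ^ (n + 3) * Y ^ (n + 4) = w * (X * Y)"
    by (simp add: w_def numeral_eq_Suc)
  also have "\<dots> = Polynomial.smult c0 w + Polynomial.smult c1 (w * q1) - Polynomial.smult c2 (w * q2)"
    unfolding XY by (simp add: algebra_simps)
  finally have "(pderiv ^^ n) (X ^ (n + 3) * Y ^ (n + 4)) =
     Polynomial.smult c0 ((pderiv ^^ n) w) + Polynomial.smult c1 ((pderiv ^^ n) (w * q1))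
     + Polynomial.smult (- c2) ((pderiv ^^ n) (w * q2))"
    by (metis diff_conv_add_uminus higher_pderiv_add higher_pderiv_smult smult_minus_left)
  moreover have "weighted_jacobi 2 3 n = (pderiv ^^ n) w"
    by (simp add: weighted_jacobi_def w_def X_def Y_def)
  moreover have "weighted_jacobi 2 3 (n + 1) = (pderiv ^^ n) (w * q1)"
    by (simp only: D1[symmetric] weighted_jacobi_def X_def Y_def funpow_1 exps)
  moreover have "weighted_jacobi 2 3 (n + 2) = (pderiv ^^ n) (w * q2)"
    by (simp only: D2[symmetric] weighted_jacobi_def X_def Y_def funpow_add o_apply exps)
  moreover have "weighted_jacobi 2 3 (n + 1) = pderiv ((pderiv ^^ n) (X ^ (n + 3) * Y ^ (n + 4)))"
    by (simp only: weighted_jacobi_def X_def Y_def exps) simp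
  ultimately show ?thesis
    by (simp add: c0_def c1_def c2_def)
qed

text \<open>The \<open>n\<close> derivatives cost at most \<open>n\<close> of the
  \<open>n + a\<close> zeros at 1 and of the \<open>n + b\<close> zeros at -1, so zeros of order at
  least \<open>a\<close> and \<open>b\<close> remain.\<close>

lemma weighted_jacobi_boundary:
  "k < a \<Longrightarrow> poly ((pderiv ^^ k) (weighted_jacobi a b n)) 1 = 0"
  "k < b \<Longrightarrow> poly ((pderiv ^^ k) (weighted_jacobi a b n)) (-1) = 0"
  unfolding weighted_jacobi_def
  using poly_higher_pderiv_eq_0[of "[:1, -1:]" "n + a" "[:1, -1:] ^ (n + a) * [:1, 1:] ^ (n + b)" "k + n" 1]
    poly_higher_pderiv_eq_0[of "[:1, 1:]" "n + b" "[:1, -1:] ^ (n + a) * [:1, 1:] ^ (n + b)" "k + n" "-1"]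
  by (simp_all add: funpow_add)

definition pairing :: "nat \<Rightarrow> nat \<Rightarrow> nat \<Rightarrow> real" where
  "pairing i m j = poly_int ((pderiv ^^ i) (weighted_jacobi 3 2 j) * weighted_jacobi 2 3 m)"

lemma pairing_Suc:
  "pairing i (n + 1) j = -
    (2 * (real n + 3) / (2 * real n + 7) * pairing (Suc i) n j
     + 2 / ((2 * real n + 7) * (2 * real n + 9)) * pairing (Suc i) (n + 1) j
     - 1 / ((2 * real n + 8) * (2 * real n + 9)) * pairing (Suc i) (n + 2) j)"
  (is "_ = - (?a * _ + ?b * _ - ?c * _)")
proof -
  \<comment> \<open>An antiderivative of $A_{n+1}$ that vanishes at both endpoints. The boundary
    terms disappear because of \<open>s\<close> alone, whatever the order \<open>i\<close> of the
    derivative of $B_j$.\<close>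
  define s where "s = Polynomial.smult ?a (weighted_jacobi 2 3 n)
    + Polynomial.smult ?b (weighted_jacobi 2 3 (n + 1))
    + Polynomial.smult (- ?c) (weighted_jacobi 2 3 (n + 2))"
  have s: "weighted_jacobi 2 3 (n + 1) = pderiv s"
    unfolding s_def using weighted_jacobi_Suc[of n] by simp
  have "poly s 1 = 0" "poly s (-1) = 0"
    using weighted_jacobi_boundary(1)[of 0 2 3] weighted_jacobi_boundary(2)[of 0 3 2] by (simp_all add: s_def)
  then have "poly_int (pderiv ((pderiv ^^ i) (weighted_jacobi 3 2 j)) * s) = - pairing i (n + 1) j"
    unfolding pairing_def s by (intro poly_int_by_parts) simp_all
  moreover have "poly_int ((pderiv ^^ Suc i) (weighted_jacobi 3 2 j) * s) =
      ?a * pairing (Suc i) n j + ?b * pairing (Suc i) (n + 1) j + - ?c * pairing (Suc i) (n + 2) j"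
    unfolding s_def pairing_def by (simp only: distrib_left mult_smult_right poly_int_add poly_int_smult)
  ultimately show ?thesis
    by simp
qed

text \<open>Reflection contributes the signs \<open>(-1) ^ (i + j)\<close> and
  \<open>(-1) ^ m\<close>, moving the \<open>i\<close> derivatives to the other factor contributes
  \<open>(-1) ^ i\<close>, and the dependence on \<open>i\<close> cancels. At each endpoint the
  orders of the zeros of the two factors add up to at least 5, hence no boundary terms up to
  \<open>i = 5\<close>.\<close>

lemma pairing_commute:
  assumes "i \<le> 5"
  shows "pairing i m j = (-1) ^ (m + j) * pairing i j m"
proof -
  have "pairing i m j = poly_int (pcompose ((pderiv ^^ i) (weighted_jacobi 3 2 j)) [:0, -1:]
      * pcompose (weighted_jacobi 2 3 m) [:0, -1:])"
    unfolding pairing_def pcompose_mult[symmetric] poly_int_reflect ..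
  also have "pcompose (weighted_jacobi 2 3 m) [:0, -1:] = Polynomial.smult ((-1) ^ m) (weighted_jacobi 3 2 m)"
    by (rule weighted_jacobi_reflect)
  also have "pcompose ((pderiv ^^ i) (weighted_jacobi 3 2 j)) [:0, -1:] =
      Polynomial.smult ((-1) ^ (i + j)) ((pderiv ^^ i) (weighted_jacobi 2 3 j))"
    by (simp add: higher_pderiv_reflect weighted_jacobi_reflect higher_pderiv_smult power_add)
  also have "poly_int (Polynomial.smult ((-1) ^ (i + j)) ((pderiv ^^ i) (weighted_jacobi 2 3 j)) *
        Polynomial.smult ((-1) ^ m) (weighted_jacobi 3 2 m))
      = (-1) ^ (i + j + m) * poly_int ((pderiv ^^ i) (weighted_jacobi 2 3 j) * weighted_jacobi 3 2 m)"
    by (simp only: mult_smult_left mult_smult_right poly_int_smult power_add) simp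
  also have "poly_int ((pderiv ^^ i) (weighted_jacobi 2 3 j) * weighted_jacobi 3 2 m) =
      (-1) ^ i * poly_int (weighted_jacobi 2 3 j * (pderiv ^^ i) (weighted_jacobi 3 2 m))"
  proof (rule poly_int_by_parts_funpow)
    fix a b and x :: real
    assume "a + b < i" "x \<in> {1, -1}"
    moreover from this have "a < 2 \<or> b < 3" "a < 3 \<or> b < 2"
      using assms by linarith+
    ultimately show "poly ((pderiv ^^ a) (weighted_jacobi 2 3 j)) x *
        poly ((pderiv ^^ b) (weighted_jacobi 3 2 m)) x = 0"
      using weighted_jacobi_boundary by auto
  qed
  finally show ?thesis
    by (simp add: pairing_def power_add mult.commute)
qed

lemma degree_weight:
  "Polynomial.degree ([:1, -1:] ^ a * [:1, 1 :: real:] ^ b) = a + b"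
  by (simp add: degree_mult_eq degree_power_eq)

text \<open>Orthogonality: the \<open>m\<close> derivatives in $A_m$ are moved onto $D^5B_j$, a
  polynomial of degree \<open>j\<close>, which they annihilate. The zeros of the weight of $A_m$
  remove all boundary terms.\<close>

lemma pairing_5_eq_0:
  assumes "j < m"
  shows "pairing 5 m j = 0"
proof -
  let ?w = "[:1, -1:] ^ (m + 2) * [:1, 1 :: real:] ^ (m + 3)"
  have "pairing 5 m j = poly_int ((pderiv ^^ m) ?w * (pderiv ^^ 5) (weighted_jacobi 3 2 j))"
    by (simp only: pairing_def weighted_jacobi_def mult.commute)
  also have "\<dots> = (-1) ^ m * poly_int (?w * (pderiv ^^ m) ((pderiv ^^ 5) (weighted_jacobi 3 2 j)))"
  proof (rule poly_int_by_parts_funpow)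
    fix a b and x :: real
    assume "a + b < m" "x \<in> {1, -1}"
    then show "poly ((pderiv ^^ a) ?w) x * poly ((pderiv ^^ b) ((pderiv ^^ 5) (weighted_jacobi 3 2 j))) x = 0"
      using poly_higher_pderiv_eq_0[of "[:1, -1:]" "m + 2" ?w a x]
        poly_higher_pderiv_eq_0[of "[:1, 1:]" "m + 3" ?w a x] by auto
  qed
  also have "(pderiv ^^ m) ((pderiv ^^ 5) (weighted_jacobi 3 2 j)) = 0"
  proof -
    let ?p = "[:1, -1:] ^ (j + 3) * [:1, 1 :: real:] ^ (j + 2)"
    have "(pderiv ^^ m) ((pderiv ^^ 5) (weighted_jacobi 3 2 j)) = (pderiv ^^ (m + 5 + j)) ?p"
      by (simp only: weighted_jacobi_def funpow_add o_apply)
    also have "m + 5 + j = (m - j) + (2 * j + 5)"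
      using assms by simp
    also have "(pderiv ^^ ((m - j) + (2 * j + 5))) ?p = (pderiv ^^ (m - j)) ((pderiv ^^ (2 * j + 5)) ?p)"
      by (simp only: funpow_add o_apply)
    also have "(pderiv ^^ (2 * j + 5)) ?p = [:fact (2 * j + 5) * Polynomial.lead_coeff ?p:]"
      by (rule higher_pderiv_const, unfold degree_weight) simp
    also have "m - j = Suc (m - j - 1)"
      using assms by simp
    finally show ?thesis
      by (simp only: funpow_Suc_right o_apply pderiv_pCons) simp
  qed
  finally show ?thesis
    by (simp add: poly_int_0)
qed

text \<open>As in \<open>pairing_5_eq_0\<close>, but for \<open>j = m\<close> the moved derivatives
  leave a constant: \<open>fact (2 * m + 5)\<close> times the leading coefficient. What remains is
  the Beta integral of the weight.\<close>

lemma pairing_5_diag: "pairing 5 m m = - (2 ^ (2 * m + 5)) * (fact (m + 2))\<^sup>2"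
proof -
  let ?w = "[:1, -1:] ^ (m + 2) * [:1, 1 :: real:] ^ (m + 3)"
  let ?p = "[:1, -1:] ^ (m + 3) * [:1, 1 :: real:] ^ (m + 2)"
  have "pairing 5 m m = poly_int ((pderiv ^^ m) ?w * (pderiv ^^ 5) (weighted_jacobi 3 2 m))"
    by (simp only: pairing_def weighted_jacobi_def mult.commute)
  also have "\<dots> = (-1) ^ m * poly_int (?w * (pderiv ^^ m) ((pderiv ^^ 5) (weighted_jacobi 3 2 m)))"
  proof (rule poly_int_by_parts_funpow)
    fix a b and x :: real
    assume "a + b < m" "x \<in> {1, -1}"
    then show "poly ((pderiv ^^ a) ?w) x * poly ((pderiv ^^ b) ((pderiv ^^ 5) (weighted_jacobi 3 2 m))) x = 0"
      using poly_higher_pderiv_eq_0[of "[:1, -1:]" "m + 2" ?w a x]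
        poly_higher_pderiv_eq_0[of "[:1, 1:]" "m + 3" ?w a x] by auto
  qed
  also have "(pderiv ^^ m) ((pderiv ^^ 5) (weighted_jacobi 3 2 m)) = (pderiv ^^ (2 * m + 5)) ?p"
  proof -
    have "(pderiv ^^ m) ((pderiv ^^ 5) (weighted_jacobi 3 2 m)) = (pderiv ^^ (m + 5 + m)) ?p"
      by (simp only: weighted_jacobi_def funpow_add o_apply)
    also have "m + 5 + m = 2 * m + 5"
      by simp
    finally show ?thesis .
  qed
  also have "\<dots> = [:fact (2 * m + 5) * Polynomial.lead_coeff ?p:]"
    by (rule higher_pderiv_const, unfold degree_weight) simp
  also have "Polynomial.lead_coeff ?p = (-1) ^ (m + 3)"
  proof -
    have "Polynomial.lead_coeff [:1, -1 :: real:] = -1" "Polynomial.lead_coeff [:1, 1 :: real:] = 1"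
      by simp_all
    then show ?thesis
      by (simp only: Polynomial.lead_coeff_mult lead_coeff_power power_one mult_1_right)
  qed
  also have "poly_int (?w * [:fact (2 * m + 5) * (-1) ^ (m + 3):]) =
      fact (2 * m + 5) * (-1) ^ (m + 3) * (2 ^ (2 * m + 6) * fact (m + 2) * fact (m + 3) / fact (2 * m + 6))"
  proof -
    have "poly_int (p * [:c:]) = c * poly_int p" for c p
      by (simp flip: poly_int_smult)
    moreover have "m + 2 + (m + 3) + 1 = 2 * m + 6"
      by simp
    ultimately show ?thesis
      by (simp only: poly_int_weight)
  qed
  also have "(fact (2 * m + 6) :: real) = 2 * (real m + 3) * fact (2 * m + 5)"
    using fact_Suc[of "2 * m + 5", where ?'a = real] by (simp add: algebra_simps)
  also have "(fact (m + 3) :: real) = (real m + 3) * fact (m + 2)"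
    by (simp add: numeral_eq_Suc algebra_simps)
  also have "(-1) ^ m * (fact (2 * m + 5) * (-1) ^ (m + 3) * (2 ^ (2 * m + 6) * fact (m + 2) *
      ((real m + 3) * fact (m + 2)) / (2 * (real m + 3) * fact (2 * m + 5)))) =
      - (2 ^ (2 * m + 5)) * (fact (m + 2))\<^sup>2"
  proof -
    have sgn: "(-1) ^ m * (-1) ^ (m + 3) = (-1 :: real)"
      by (simp add: power_add flip: power_mult_distrib)
    have pow: "(2::real) ^ (2 * m + 6) = 2 * 2 ^ (2 * m + 5)"
      by (simp add: power_add)
    have nz: "real m + 3 \<noteq> 0"
      by linarith
    \<comment> \<open>The cancellation is stated for abstract letters so that powers and factorials
      stay closed; \<open>M\<close> stands for \<open>real m + 3\<close> and \<open>F\<close> for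
      \<open>fact (2 * m + 5)\<close>.\<close>
    have "e * (F * e' * (2 * P * A * (M * A) / (2 * M * F))) = e * e' * (P * A\<^sup>2)"
      if "M \<noteq> 0" "F \<noteq> 0" for e e' F P A M :: real
      using that by (simp add: power2_eq_square)
    note this[OF nz fact_nonzero]
    then show ?thesis
      by (simp only: pow sgn mult_minus_left mult_1_left)
  qed
  finally show ?thesis .
qed

section \<open>Rational identities between the matrix entries\<close>

text \<open>The linear factors of the denominators in the various shapes that simplification gives
  them, so that \<open>divide_simps\<close> can clear denominators without case splits.\<close>

lemma add_mult_pos_neq_0:
  fixes x :: real
  assumes "x \<ge> 0"
  shows "x + numeral w \<noteq> 0" "x + 1 \<noteq> 0" "numeral w + x \<noteq> 0" "1 + x \<noteq> 0"
    "x * numeral v + numeral w \<noteq> 0" "x * numeral v + 1 \<noteq> 0"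
    "numeral v * x + numeral w \<noteq> 0" "numeral v * x + 1 \<noteq> 0"
    "numeral w + x * numeral v \<noteq> 0" "1 + x * numeral v \<noteq> 0"
    "numeral w + numeral v * x \<noteq> 0" "1 + numeral v * x \<noteq> 0"
  using assms by (smt (verit) zero_less_numeral zero_le_mult_iff)+

lemma add_half_eq:
  fixes x :: real
  shows "x + 1/2 = (2 * x + 1) / 2" "x + 3/2 = (2 * x + 3) / 2" "x + 5/2 = (2 * x + 5) / 2"
    "x + 7/2 = (2 * x + 7) / 2" "x + 9/2 = (2 * x + 9) / 2" "x + 11/2 = (2 * x + 11) / 2"
    "x + 13/2 = (2 * x + 13) / 2" "x + 15/2 = (2 * x + 15) / 2" "x + 17/2 = (2 * x + 17) / 2"
  by (simp_all add: field_simps)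

lemma pochhammer_numeral_expand:
  fixes x :: real
  shows "pochhammer x 2 = x * (x + 1)"
    "pochhammer x 3 = x * (x + 1) * (x + 2)"
    "pochhammer x 4 = x * (x + 1) * (x + 2) * (x + 3)"
    "pochhammer x 5 = x * (x + 1) * (x + 2) * (x + 3) * (x + 4)"
    "pochhammer x 6 = x * (x + 1) * (x + 2) * (x + 3) * (x + 4) * (x + 5)"
  by (simp_all add: numeral_eq_Suc pochhammer_Suc add_ac)

text \<open>Instances for integer shifts only: in the symmetry lemmas the half-integer Pochhammer
  symbols agree on both sides, so they stay closed and only need to be nonzero.\<close>

lemmas pochhammer_integer_expand =
  pochhammer_numeral_expand[of "x + numeral v" for x v]
  pochhammer_numeral_expand[of "x + 1" for x]

lemma pochhammer_half_neq_0:
  "pochhammer (real k + 1/2) n \<noteq> 0" "pochhammer (real k + numeral v / 2) n \<noteq> 0"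
proof -
  have "real k + 1/2 > 0" "real k + numeral v / 2 > 0"
    by (simp_all add: add_nonneg_pos)
  then show "pochhammer (real k + 1/2) n \<noteq> 0" "pochhammer (real k + numeral v / 2) n \<noteq> 0"
    by (metis less_irrefl pochhammer_pos)+
qed

lemmas entry_expand = pochhammer_numeral_expand add_half_eq add.assoc r_def

text \<open>The recurrence for the rows in the normalisation of the matrix entries; the first index of
  \<open>row_rec G n j\<close> is one less than the row it describes.\<close>

definition row_rec :: "(nat \<Rightarrow> nat \<Rightarrow> real) \<Rightarrow> nat \<Rightarrow> nat \<Rightarrow> real" where
  "row_rec G n j = (real n + 6) / ((real n + 1) * (2 * real n + 7)) * G n j
     - 2 / ((2 * real n + 7) * (2 * real n + 9)) * G (n + 1) j
     - (real n + 2) / ((real n + 7) * (2 * real n + 9)) * G (n + 2) j"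

text \<open>The entries $(k, j)$ divided by this weight are symmetric up to the sign $(-1)^{k+j}$.\<close>

definition reflect_weight :: "nat \<Rightarrow> real" where
  "reflect_weight k = (real k + 1) * (real k + 2) * (real k + 3)\<^sup>2 * (real k + 4) * (real k + 5)"

text \<open>In this lemma and the next four, each offset between row and column is one rational
  identity in the index, and in the last case all entries involved lie outside their bands. The
  minus signs at \<open>b2\<close>, \<open>g2\<close> and \<open>g1\<close> are those of $u^{(5)}$,
  $u''$ and $u'$ in the differential equation.\<close>

lemma row_rec_g4:
  assumes "j \<le> n + 1"
  shows "g4 (n + 1) j = row_rec (\<lambda>k j. - b2 k j) n j"
proof -
  consider "j = n + 1" | "n = j" | "n \<ge> j + 1"
    using assms by linarith
  then show ?thesis
    by cases
      (simp add: row_rec_def g4_def b2_def entry_expand; simp add: add_mult_pos_neq_0 divide_simps;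
        simp add: algebra_simps)+
qed

lemma row_rec_g3:
  assumes "j \<le> n + 1"
  shows "g3 (n + 1) j = row_rec g4 n j"
proof -
  consider "j = n + 1" | "n = j" | "n = j + 1" | "n \<ge> j + 2"
    using assms by linarith
  then show ?thesis
    by cases
      (simp add: row_rec_def g3_def g4_def entry_expand; simp add: add_mult_pos_neq_0 divide_simps;
        simp add: algebra_simps)+
qed

lemma row_rec_g2:
  assumes "j \<le> n + 1"
  shows "- g2 (n + 1) j = row_rec g3 n j"
proof -
  consider "j = n + 1" | "n = j" | "n = j + 1" | "n = j + 2" | "n \<ge> j + 3"
    using assms by linarith
  then show ?thesis
    by cases
      (simp add: row_rec_def g2_def g3_def entry_expand; simp add: add_mult_pos_neq_0 divide_simps;
        simp add: algebra_simps)+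
qed

lemma row_rec_g1:
  assumes "j \<le> n + 1"
  shows "- g1 (n + 1) j = row_rec (\<lambda>k j. - g2 k j) n j"
proof -
  consider "j = n + 1" | "n = j" | "n = j + 1" | "n = j + 2" | "n = j + 3" | "n \<ge> j + 4"
    using assms by linarith
  then show ?thesis
    by cases
      (simp add: row_rec_def g1_def g2_def entry_expand; simp add: add_mult_pos_neq_0 divide_simps;
        simp add: algebra_simps)+
qed

lemma row_rec_g0:
  assumes "j \<le> n + 1"
  shows "g0 (n + 1) j = row_rec (\<lambda>k j. - g1 k j) n j"
proof -
  consider "j = n + 1" | "n = j" | "n = j + 1" | "n = j + 2" | "n = j + 3" | "n = j + 4" | "n \<ge> j + 5"
    using assms by linarith
  then show ?thesis
  proof cases
    case 1
    then show ?thesis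
      by (simp add: row_rec_def g0_def g1_def entry_expand; simp add: add_mult_pos_neq_0 divide_simps;
        simp add: algebra_simps)
  next
    case 2
    then show ?thesis
      by (simp add: row_rec_def g0_def g1_def entry_expand; simp add: add_mult_pos_neq_0 divide_simps;
        simp add: algebra_simps)
  next
    case 3
    then show ?thesis
      by (simp add: row_rec_def g0_def g1_def entry_expand; simp add: add_mult_pos_neq_0 divide_simps;
        simp add: algebra_simps)
  next
    case 4
    then show ?thesis
      by (simp add: row_rec_def g0_def g1_def entry_expand; simp add: add_mult_pos_neq_0 divide_simps;
        simp add: algebra_simps)
  next
    case 5
    then show ?thesis
      by (simp add: row_rec_def g0_def g1_def entry_expand; simp add: add_mult_pos_neq_0 divide_simps;
        simp add: algebra_simps)
  next
    case 6
    then show ?thesis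
      by (simp add: row_rec_def g0_def g1_def entry_expand; simp add: add_mult_pos_neq_0 divide_simps;
        simp add: algebra_simps)
  next
    case 7
    then show ?thesis
      by (simp add: row_rec_def g0_def g1_def entry_expand; simp add: add_mult_pos_neq_0 divide_simps;
        simp add: algebra_simps)
  qed
qed

text \<open>This symmetry carries the closed forms from below the diagonal, where the recurrence is
  checked, to above it. Each offset inside the band is one rational identity in \<open>k\<close>;
  outside the band both entries are zero.\<close>

lemma reflect_g4:
  assumes "k < j"
  shows "g4 k j = (-1) ^ (k + j) * reflect_weight k / reflect_weight j * g4 j k"
proof -
  consider "j = k + 1" | "j > k + 1"
    using assms by linarith
  then show ?thesis
    by cases
      (simp add: reflect_weight_def g4_def r_def pochhammer_integer_expand;
        simp add: pochhammer_half_neq_0 add_mult_pos_neq_0 divide_simps;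
        simp add: algebra_simps power2_eq_square)+
qed

lemma reflect_g3:
  assumes "k < j"
  shows "g3 k j = (-1) ^ (k + j) * reflect_weight k / reflect_weight j * g3 j k"
proof -
  consider "j = k + 1" | "j = k + 2" | "j > k + 2"
    using assms by linarith
  then show ?thesis
    by cases
      (simp add: reflect_weight_def g3_def r_def pochhammer_integer_expand;
        simp add: pochhammer_half_neq_0 add_mult_pos_neq_0 divide_simps;
        simp add: algebra_simps power2_eq_square)+
qed

lemma reflect_g2:
  assumes "k < j"
  shows "g2 k j = (-1) ^ (k + j) * reflect_weight k / reflect_weight j * g2 j k"
proof -
  consider "j = k + 1" | "j = k + 2" | "j = k + 3" | "j > k + 3"
    using assms by linarith
  then show ?thesis
    by cases
      (simp add: reflect_weight_def g2_def r_def pochhammer_integer_expand;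
        simp add: pochhammer_half_neq_0 add_mult_pos_neq_0 divide_simps;
        simp add: algebra_simps power2_eq_square)+
qed

lemma reflect_g1:
  assumes "k < j"
  shows "g1 k j = (-1) ^ (k + j) * reflect_weight k / reflect_weight j * g1 j k"
proof -
  consider "j = k + 1" | "j = k + 2" | "j = k + 3" | "j = k + 4" | "j > k + 4"
    using assms by linarith
  then show ?thesis
    by cases
      (simp add: reflect_weight_def g1_def r_def pochhammer_integer_expand;
        simp add: pochhammer_half_neq_0 add_mult_pos_neq_0 divide_simps;
        simp add: algebra_simps power2_eq_square)+
qed

lemma reflect_g0:
  assumes "k < j"
  shows "g0 k j = (-1) ^ (k + j) * reflect_weight k / reflect_weight j * g0 j k"
proof -
  consider "j = k + 1" | "j = k + 2" | "j = k + 3" | "j = k + 4" | "j = k + 5" | "j > k + 5"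
    using assms by linarith
  then show ?thesis
    by cases
      (simp add: reflect_weight_def g0_def r_def pochhammer_integer_expand;
        simp add: pochhammer_half_neq_0 add_mult_pos_neq_0 divide_simps;
        simp add: algebra_simps power2_eq_square)+
qed

section \<open>The matrix entries as integrals\<close>

lemma ip_poly: "ip (poly p) (poly q) = poly_int (p * q)"
proof -
  have "poly (p * q) = (\<lambda>x. poly p x * poly q x)"
    by (rule ext) simp
  then show ?thesis
    by (simp only: ip_def poly_int_def)
qed

text \<open>Both sides are multiples of the weight times the same \<open>rodrigues_poly\<close>; at
  natural parameters the Gamma quotient becomes a quotient of factorials.\<close>

lemma weighted_jacobi_eq_smult_jacobiR:
  "[:1, -1:] ^ a * [:1, 1:] ^ b * jacobiR (real a) (real b) n =
   Polynomial.smult ((- 1 / 2) ^ n * fact a / fact (n + a)) (weighted_jacobi a b n)"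
proof -
  have "weighted_jacobi a b n = [:1, -1:] ^ a * [:1, 1:] ^ b * rodrigues_poly (real a + real n) (real b + real n) n"
    using higher_pderiv_weight[of n "n + a" "n + b"] by (simp add: weighted_jacobi_def add.commute)
  moreover have "Gamma (real a + 1) = fact a" "Gamma (real n + real a + 1) = fact (n + a)"
    using Gamma_fact[of a, where ?'a = real] Gamma_fact[of "n + a", where ?'a = real]
    by (simp_all add: add_ac)
  ultimately show ?thesis
    by (simp add: jacobiR_eq_rodrigues_poly)
qed

lemma J32_eq: "J32 (n + 5) = Polynomial.smult ((- 1 / 2) ^ n * 6 / fact (n + 3)) (weighted_jacobi 3 2 n)"
proof -
  have "J32 (n + 5) = [:1, -1:] ^ 3 * [:1, 1:] ^ 2 * jacobiR (real 3) (real 2) n"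
    by (simp add: J32_def power2_eq_square power3_eq_cube)
  also have "\<dots> = Polynomial.smult ((- 1 / 2) ^ n * fact 3 / fact (n + 3)) (weighted_jacobi 3 2 n)"
    by (rule weighted_jacobi_eq_smult_jacobiR)
  also have "(fact 3 :: real) = 6"
    by (simp add: fact_numeral)
  finally show ?thesis .
qed

lemma J23_eq: "J23 (n + 5) = Polynomial.smult ((- 1 / 2) ^ n * 2 / fact (n + 2)) (weighted_jacobi 2 3 n)"
proof -
  have "J23 (n + 5) = [:1, -1:] ^ 2 * [:1, 1:] ^ 3 * jacobiR (real 2) (real 3) n"
    by (simp add: J23_def power2_eq_square power3_eq_cube)
  also have "\<dots> = Polynomial.smult ((- 1 / 2) ^ n * fact 2 / fact (n + 2)) (weighted_jacobi 2 3 n)"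
    by (rule weighted_jacobi_eq_smult_jacobiR)
  also have "(fact 2 :: real) = 2"
    by simp
  finally show ?thesis .
qed

text \<open>The factor in front of the integral in \<open>fstar\<close>: row \<open>k\<close> of the
  system is the variational equation tested with \<open>J23 (k + 5)\<close> and multiplied by this
  number.\<close>

definition row_scale :: "nat \<Rightarrow> real" where
  "row_scale k = (real k + 1) * (real k + 2) * (real k + 3) * (real k + 4) * (real k + 5) / 128"

definition galerkin_entry :: "nat \<Rightarrow> nat \<Rightarrow> nat \<Rightarrow> real" where
  "galerkin_entry i k j = row_scale k * ip (poly ((pderiv ^^ i) (J32 (j + 5)))) (poly (J23 (k + 5)))"

text \<open>Writing \<open>fact (k + 2)\<close> as \<open>fact (k + 3) / (real k + 3)\<close>
  completes \<open>row_scale\<close> to a multiple of \<open>reflect_weight\<close>; the rest of the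
  prefactor is symmetric in \<open>k\<close> and \<open>j\<close>.\<close>

lemma galerkin_entry_eq_pairing:
  "galerkin_entry i k j = reflect_weight k * (- 1 / 2) ^ (k + j) * 3 / (32 * fact (k + 3) * fact (j + 3))
    * pairing i k j"
proof -
  have "(fact (k + 3) :: real) = (real k + 3) * fact (k + 2)"
    by (simp add: numeral_eq_Suc algebra_simps)
  moreover have "real k + 3 \<noteq> 0"
    by linarith
  moreover have "galerkin_entry i k j = row_scale k * ((- 1 / 2) ^ k * 2 / fact (k + 2) *
      ((- 1 / 2) ^ j * 6 / fact (j + 3) * pairing i k j))"
    by (simp only: galerkin_entry_def ip_poly J32_eq J23_eq higher_pderiv_smult mult_smult_left mult_smult_right
        poly_int_smult pairing_def)
  ultimately show ?thesis
    by (simp add: row_scale_def reflect_weight_def power_add power2_eq_square del: fact_Suc)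
qed

lemma galerkin_entry_Suc: "galerkin_entry i (n + 1) j = row_rec (galerkin_entry (Suc i)) n j"
proof -
  \<comment> \<open>\<open>c\<close> is the prefactor of row \<open>n + 1\<close>. The brackets in
    \<open>E0\<close> and \<open>E2\<close> are the ratios of the prefactors of rows
    \<open>n\<close> and \<open>n + 2\<close> to it, and they turn the coefficients of
    \<open>pairing_Suc\<close> into those of \<open>row_rec\<close>.\<close>
  define c where "c = reflect_weight (n + 1) * (- 1 / 2) ^ (n + 1 + j) * 3 / (32 * fact (n + 4) * fact (j + 3))"
  define x where "x = real n"
  have x: "x \<ge> 0"
    by (simp add: x_def)
  have f4: "fact (n + 4) = (x + 4) * (fact (n + 3) :: real)"
    by (simp add: x_def numeral_eq_Suc algebra_simps)
  have f5: "fact (n + 2 + 3) = (x + 5) * (fact (n + 4) :: real)"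
    by (simp add: x_def numeral_eq_Suc algebra_simps)
  have E0: "galerkin_entry (Suc i) n j = c * (- 2 * (x + 1) * (x + 3) / (x + 6)) * pairing (Suc i) n j"
    unfolding galerkin_entry_eq_pairing c_def f4 using x
    by (simp add: reflect_weight_def add_mult_pos_neq_0 divide_simps flip: x_def)
      (simp add: algebra_simps power2_eq_square)
  have E1: "galerkin_entry i' (n + 1) j = c * pairing i' (n + 1) j" for i'
    unfolding galerkin_entry_eq_pairing c_def by (simp add: add.commute)
  have E2: "galerkin_entry (Suc i) (n + 2) j = c * (- (x + 7) / (2 * (x + 2) * (x + 4))) * pairing (Suc i) (n + 2) j"
    unfolding galerkin_entry_eq_pairing c_def f5 using x
    by (simp add: reflect_weight_def add_mult_pos_neq_0 divide_simps flip: x_def)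
      (simp add: algebra_simps power2_eq_square)
  show ?thesis
    unfolding row_rec_def E0 E1 E2 pairing_Suc[of i n j] x_def[symmetric] using x
    by (simp add: add_mult_pos_neq_0 divide_simps) (simp add: algebra_simps)
qed

lemma galerkin_entry_commute:
  assumes "i \<le> 5"
  shows "galerkin_entry i k j = (-1) ^ (k + j) * reflect_weight k / reflect_weight j * galerkin_entry i j k"
proof -
  have "reflect_weight j \<noteq> 0"
    unfolding reflect_weight_def by (simp add: add_mult_pos_neq_0)
  then show ?thesis
    unfolding galerkin_entry_eq_pairing pairing_commute[OF assms, of k j]
    by (simp add: add.commute mult_ac)
qed

text \<open>One step of the descent from \<open>Suc i\<close> to \<open>i\<close>: the recurrence
  gives rows \<open>k\<close> with \<open>k > 0\<close> up to the diagonal, row 0 contributes only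
  the corner there, and the symmetry gives the entries above the diagonal.\<close>

lemma galerkin_entry_eqI:
  assumes "\<And>n j. j \<le> n + 1 \<Longrightarrow> G (n + 1) j = row_rec (galerkin_entry (Suc i)) n j"
    and "\<And>k j. k < j \<Longrightarrow> G k j = (-1) ^ (k + j) * reflect_weight k / reflect_weight j * G j k"
    and "galerkin_entry i 0 0 = G 0 0" "i \<le> 5"
  shows "galerkin_entry i = G"
proof (intro ext)
  have le: "galerkin_entry i k j = G k j" if "j \<le> k" for k j
    using that assms(1,3) galerkin_entry_Suc[of i "k - 1" j] by (cases k) auto
  fix k j
  show "galerkin_entry i k j = G k j"
    using le galerkin_entry_commute[OF assms(4), of k j] assms(2)[of k j] by (cases "j \<le> k") auto
qed

lemma galerkin_entry_5: "galerkin_entry 5 = (\<lambda>k j. - b2 k j)"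
proof (intro ext)
  fix k j :: nat
  consider "j < k" | "k < j" | "j = k"
    by linarith
  then show "galerkin_entry 5 k j = - b2 k j"
  proof cases
    case 1
    then show ?thesis
      by (simp add: galerkin_entry_eq_pairing pairing_5_eq_0 b2_def)
  next
    case 2
    then show ?thesis
      by (simp add: galerkin_entry_eq_pairing pairing_commute[of 5 k j] pairing_5_eq_0 b2_def)
  next
    case 3
    have "(fact (k + 3) :: real) = (real k + 3) * fact (k + 2)"
      by (simp add: numeral_eq_Suc algebra_simps)
    moreover have "real k + 3 \<noteq> 0"
      by linarith
    moreover have "(- 1 / 2) ^ (k + k) * (2::real) ^ (2 * k + 5) = 32"
    proof -
      have "(- 1 / 2 :: real) ^ (k + k) = (1 / 4) ^ k" "(2::real) ^ (2 * k + 5) = 4 ^ k * 32"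
        by (simp_all add: power_add power_mult flip: power_mult_distrib)
      moreover have "(1 / 4 :: real) ^ k * 4 ^ k = 1"
        by (simp flip: power_mult_distrib)
      ultimately show ?thesis
        by simp
    qed
    \<comment> \<open>Again an identity in abstract letters; \<open>m\<close> stands for
      \<open>real k + 3\<close> and \<open>F\<close> for \<open>fact (k + 2)\<close>.\<close>
    moreover have "w * e * 3 / (32 * (m * F) * (m * F)) * (- P * F\<^sup>2) = - (w * 3 / (32 * m\<^sup>2)) * (e * P)"
      if "m \<noteq> 0" "F \<noteq> 0" for w e m F P :: real
      using that by (simp add: power2_eq_square)
    ultimately have "galerkin_entry 5 k k = - (reflect_weight k * 3 / (32 * (real k + 3)\<^sup>2)) * 32"
      unfolding galerkin_entry_eq_pairing pairing_5_diag by (metis fact_nonzero)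
    moreover have "reflect_weight k = r k / 3 * (real k + 3)\<^sup>2"
      by (simp add: reflect_weight_def r_def) (simp add: algebra_simps)
    ultimately show ?thesis
      using \<open>real k + 3 \<noteq> 0\<close> by (simp add: 3 b2_def)
  qed
qed

lemma pairing_0_0:
  "pairing 0 0 0 = 512/693" "pairing 1 0 0 = -256/315" "pairing 2 0 0 = -512/315"
  "pairing 3 0 0 = 256/35" "pairing 4 0 0 = 256/35"
proof -
  have expand: "weighted_jacobi 3 2 0 = [:1, -1, -2, 2, 1, -1:]"
    "weighted_jacobi 2 3 0 = [:1, 1, -2, -2, 1, 1:]"
    by (simp_all add: weighted_jacobi_def eval_nat_numeral)
  \<comment> \<open>Each integrand is written as the derivative of an explicit antiderivative, so
    the integrals are read off from endpoint values.\<close>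
  have "(pderiv ^^ 0) (weighted_jacobi 3 2 0) * weighted_jacobi 2 3 0 = pderiv [:0, 1, 0, -5/3, 0, 2, 0, -10/7, 0, 5/9, 0, -1/11:]"
    "(pderiv ^^ 1) (weighted_jacobi 3 2 0) * weighted_jacobi 2 3 0 = pderiv [:0, -1, -5/2, 4/3, 5, -6/5, -5, 4/7, 5/2, -1/9, -1/2:]"
    "(pderiv ^^ 2) (weighted_jacobi 3 2 0) * weighted_jacobi 2 3 0 = pderiv [:0, -4, 4, 32/3, -6, -72/5, 4, 64/7, -1, -20/9:]"
    "(pderiv ^^ 3) (weighted_jacobi 3 2 0) * weighted_jacobi 2 3 0 = pderiv [:0, 12, 18, -20, -33, 84/5, 26, -36/7, -15/2:]"
    "(pderiv ^^ 4) (weighted_jacobi 3 2 0) * weighted_jacobi 2 3 0 = pderiv [:0, 24, -48, -56, 48, 264/5, -16, -120/7:]"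
    unfolding expand by (simp_all add: eval_nat_numeral pderiv_pCons)
  then show "pairing 0 0 0 = 512/693" "pairing 1 0 0 = -256/315" "pairing 2 0 0 = -512/315"
    "pairing 3 0 0 = 256/35" "pairing 4 0 0 = 256/35"
    unfolding pairing_def by (simp_all only: poly_int_pderiv) simp_all
qed

lemma galerkin_entry_0_0: "galerkin_entry i 0 0 = 15/16 * pairing i 0 0"
  by (simp add: galerkin_entry_eq_pairing reflect_weight_def fact_numeral)

section \<open>Closed forms of the entries, descending from the fifth derivative\<close>

lemma galerkin_entry_4: "galerkin_entry 4 = g4"
proof (rule galerkin_entry_eqI)
  show "g4 (n + 1) j = row_rec (galerkin_entry (Suc 4)) n j" if "j \<le> n + 1" for n j
    using row_rec_g4[OF that] galerkin_entry_5 by simp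
  show "galerkin_entry 4 0 0 = g4 0 0"
    by (simp add: galerkin_entry_0_0 pairing_0_0 g4_def r_def pochhammer_numeral_expand)
qed (simp_all add: reflect_g4)

lemma galerkin_entry_3: "galerkin_entry 3 = g3"
proof (rule galerkin_entry_eqI)
  show "g3 (n + 1) j = row_rec (galerkin_entry (Suc 3)) n j" if "j \<le> n + 1" for n j
    using row_rec_g3[OF that] galerkin_entry_4 by simp
  show "galerkin_entry 3 0 0 = g3 0 0"
    by (simp add: galerkin_entry_0_0 pairing_0_0 g3_def r_def pochhammer_numeral_expand)
qed (simp_all add: reflect_g3)

lemma galerkin_entry_2: "galerkin_entry 2 = (\<lambda>k j. - g2 k j)"
proof (rule galerkin_entry_eqI)
  show "- g2 (n + 1) j = row_rec (galerkin_entry (Suc 2)) n j" if "j \<le> n + 1" for n j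
    using row_rec_g2[OF that] galerkin_entry_3 by simp
  show "galerkin_entry 2 0 0 = - g2 0 0"
    by (simp add: galerkin_entry_0_0 pairing_0_0 g2_def r_def pochhammer_numeral_expand)
qed (simp_all add: reflect_g2)

lemma galerkin_entry_1: "galerkin_entry 1 = (\<lambda>k j. - g1 k j)"
proof (rule galerkin_entry_eqI)
  show "- g1 (n + 1) j = row_rec (galerkin_entry (Suc 1)) n j" if "j \<le> n + 1" for n j
    using row_rec_g1[OF that] galerkin_entry_2 by (simp add: numeral_2_eq_2)
  show "galerkin_entry 1 0 0 = - g1 0 0"
    by (simp add: galerkin_entry_0_0 pairing_0_0[unfolded One_nat_def] g1_def r_def pochhammer_numeral_expand)
qed (simp_all add: reflect_g1)

lemma galerkin_entry_0: "galerkin_entry 0 = g0"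
proof (rule galerkin_entry_eqI)
  show "g0 (n + 1) j = row_rec (galerkin_entry (Suc 0)) n j" if "j \<le> n + 1" for n j
    using row_rec_g0[OF that] galerkin_entry_1 by simp
  show "galerkin_entry 0 0 0 = g0 0 0"
    by (simp add: galerkin_entry_0_0 pairing_0_0 g0_def r_def pochhammer_numeral_expand)
qed (simp_all add: reflect_g0)

section \<open>From the variational equations to the rows of the linear system\<close>

lemma J23_in_test_space:
  assumes "k \<le> N - 5"
  shows "J23 (k + 5) \<in> test_space N"
proof -
  interpret Modules.module "Polynomial.smult :: real \<Rightarrow> real poly \<Rightarrow> real poly"
    by unfold_locales (simp_all add: smult_add_left smult_add_right)
  show ?thesis
    unfolding test_space_def using assms by (intro span_base) auto
qed

lemma fstar_eq: "fstar f k = row_scale k * ip f (poly (J23 (k + 5)))"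
proof -
  have "f x * poly (J23 (k + 5)) x = (1 - x\<^sup>2)\<^sup>2 * (1 + x) * f x * poly (jacobiR 2 3 k) x" for x
    by (simp add: J23_def power2_eq_square algebra_simps)
  then show ?thesis
    by (simp only: fstar_def row_scale_def ip_def)
qed

lemma ip_pderiv_sum:
  "row_scale k * ip (poly ((pderiv ^^ i) (\<Sum>j\<in>A. Polynomial.smult (a j) (J32 (j + 5))))) (poly (J23 (k + 5)))
    = (\<Sum>j\<in>A. galerkin_entry i k j * a j)"
  by (simp add: galerkin_entry_def ip_poly higher_pderiv_sum higher_pderiv_smult sum_distrib_right poly_int_sum
      poly_int_smult sum_distrib_left mult_ac)

lemma galerkin_row:
  fixes a :: "nat \<Rightarrow> real"
  assumes "dual_petrov_galerkin N \<alpha> \<beta> \<gamma> \<delta> \<mu> f (\<Sum>j = 0..N - 5. Polynomial.smult (a j) (J32 (j + 5)))"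
    and "k \<le> N - 5"
  shows "(\<Sum>j = 0..N - 5. (b2 k j + \<alpha> * g4 k j + \<beta> * g3 k j + \<gamma> * g2 k j + \<delta> * g1 k j + \<mu> * g0 k j) * a j)
    = fstar f k"
proof -
  define u where "u = (\<Sum>j = 0..N - 5. Polynomial.smult (a j) (J32 (j + 5)))"
  define I where "I i = row_scale k * ip (poly ((pderiv ^^ i) u)) (poly (J23 (k + 5)))" for i
  \<comment> \<open>The terms in $u'$ and $u$ are written with iterates 1 and 0 so that
    \<open>I\<close> covers all six orders uniformly.\<close>
  have eq: "- ip (poly ((pderiv ^^ 5) u)) (poly (J23 (k + 5)))
      + \<alpha> * ip (poly ((pderiv ^^ 4) u)) (poly (J23 (k + 5)))
      + \<beta> * ip (poly ((pderiv ^^ 3) u)) (poly (J23 (k + 5)))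
      - \<gamma> * ip (poly ((pderiv ^^ 2) u)) (poly (J23 (k + 5)))
      - \<delta> * ip (poly ((pderiv ^^ 1) u)) (poly (J23 (k + 5)))
      + \<mu> * ip (poly ((pderiv ^^ 0) u)) (poly (J23 (k + 5)))
      = ip f (poly (J23 (k + 5)))"
    using assms(1) J23_in_test_space[OF assms(2)] by (simp add: dual_petrov_galerkin_def u_def)
  have "fstar f k = - I 5 + \<alpha> * I 4 + \<beta> * I 3 - \<gamma> * I 2 - \<delta> * I 1 + \<mu> * I 0"
    unfolding fstar_eq I_def eq[symmetric] by (simp add: algebra_simps)
  moreover have "I i = (\<Sum>j = 0..N - 5. galerkin_entry i k j * a j)" for i
    unfolding I_def u_def by (rule ip_pderiv_sum)
  \<comment> \<open>The minus signs in the equation meet those in \<open>galerkin_entry_5\<close>,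
    \<open>galerkin_entry_2\<close> and \<open>galerkin_entry_1\<close>, so every matrix enters with
    a plus sign.\<close>
  ultimately show ?thesis
    by (simp add: galerkin_entry_0 galerkin_entry_1[unfolded One_nat_def] galerkin_entry_2 galerkin_entry_3 galerkin_entry_4 galerkin_entry_5
        sum_distrib_left sum.distrib sum_negf algebra_simps)
qed

section \<open>Nonvanishing of the entries inside the bands\<close>

lemma pochhammer_integer_neq_0:
  "pochhammer (real k + 1) n \<noteq> 0" "pochhammer (real k + numeral v) n \<noteq> 0"
proof -
  have "real k + 1 > 0" "real k + numeral v > 0"
    by (simp_all add: add_nonneg_pos)
  then show "pochhammer (real k + 1) n \<noteq> 0" "pochhammer (real k + numeral v) n \<noteq> 0"
    by (metis less_irrefl pochhammer_pos)+
qed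

lemma r_neq_0: "r k \<noteq> 0"
  by (simp add: r_def add_mult_pos_neq_0)

lemmas entry_neq_0 = r_neq_0 pochhammer_integer_neq_0 pochhammer_half_neq_0 add_mult_pos_neq_0

lemma b2_neq_0_iff: "b2 k j \<noteq> 0 \<longleftrightarrow> k = j"
  by (auto simp: b2_def r_neq_0)

text \<open>Once all factors are known to be nonzero, only the case distinction on the indices is
  left, and it is linear arithmetic.\<close>

lemma g4_neq_0_iff: "g4 k j \<noteq> 0 \<longleftrightarrow> \<bar>int k - int j\<bar> \<le> 1"
  by (simp add: g4_def entry_neq_0; arith)

lemma g3_neq_0_iff: "g3 k j \<noteq> 0 \<longleftrightarrow> \<bar>int k - int j\<bar> \<le> 2"
  by (simp add: g3_def entry_neq_0; arith)

lemma g2_neq_0_iff: "g2 k j \<noteq> 0 \<longleftrightarrow> \<bar>int k - int j\<bar> \<le> 3"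
  by (simp add: g2_def entry_neq_0; arith)

lemma g1_neq_0_iff: "g1 k j \<noteq> 0 \<longleftrightarrow> \<bar>int k - int j\<bar> \<le> 4"
  by (simp add: g1_def entry_neq_0; arith)

lemma g0_neq_0_iff: "g0 k j \<noteq> 0 \<longleftrightarrow> \<bar>int k - int j\<bar> \<le> 5"
  by (simp add: g0_def entry_neq_0; arith)

theorem theorem4:
  fixes N :: nat and \<alpha>\<^sub>2 \<beta>\<^sub>2 \<gamma>\<^sub>2 \<delta>\<^sub>2 \<mu>\<^sub>2 :: real
    and f :: "real \<Rightarrow> real" and a :: "nat \<Rightarrow> real" and u\<^sub>N :: "real poly"
  assumes "N \<ge> 5"
    and "\<And>v. v \<in> test_space N \<Longrightarrow> (\<lambda>x. f x * poly v x) integrable_on {-1..1}"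
    and "u\<^sub>N = (\<Sum>k = 0..N - 5. Polynomial.smult (a k) (J32 (k + 5)))"
    and "dual_petrov_galerkin N \<alpha>\<^sub>2 \<beta>\<^sub>2 \<gamma>\<^sub>2 \<delta>\<^sub>2 \<mu>\<^sub>2 f u\<^sub>N"
  shows "(sqmat N b2 + \<alpha>\<^sub>2 \<cdot>\<^sub>m sqmat N g4 + \<beta>\<^sub>2 \<cdot>\<^sub>m sqmat N g3 + \<gamma>\<^sub>2 \<cdot>\<^sub>m sqmat N g2
            + \<delta>\<^sub>2 \<cdot>\<^sub>m sqmat N g1 + \<mu>\<^sub>2 \<cdot>\<^sub>m sqmat N g0) *\<^sub>v Matrix.vec (N - 4) a
         = Matrix.vec (N - 4) (fstar f)
       \<and> (\<forall>k \<le> N - 5. \<forall>j \<le> N - 5.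
            (b2 k j \<noteq> 0 \<longleftrightarrow> k = j)
          \<and> (g4 k j \<noteq> 0 \<longleftrightarrow> \<bar>int k - int j\<bar> \<le> 1)
          \<and> (g3 k j \<noteq> 0 \<longleftrightarrow> \<bar>int k - int j\<bar> \<le> 2)
          \<and> (g2 k j \<noteq> 0 \<longleftrightarrow> \<bar>int k - int j\<bar> \<le> 3)
          \<and> (g1 k j \<noteq> 0 \<longleftrightarrow> \<bar>int k - int j\<bar> \<le> 4)
          \<and> (g0 k j \<noteq> 0 \<longleftrightarrow> \<bar>int k - int j\<bar> \<le> 5))"
proof
  \<comment> \<open>Both subtractions are truncated; the two ranges agree only because
    \<open>N\<close> is at least 5.\<close>
  have idx: "{0..<N - 4} = {0..N - 5}"
    using assms(1) by auto
  show "(sqmat N b2 + \<alpha>\<^sub>2 \<cdot>\<^sub>m sqmat N g4 + \<beta>\<^sub>2 \<cdot>\<^sub>m sqmat N g3 + \<gamma>\<^sub>2 \<cdot>\<^sub>m sqmat N g2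
            + \<delta>\<^sub>2 \<cdot>\<^sub>m sqmat N g1 + \<mu>\<^sub>2 \<cdot>\<^sub>m sqmat N g0) *\<^sub>v Matrix.vec (N - 4) a
         = Matrix.vec (N - 4) (fstar f)" (is "?M *\<^sub>v _ = _")
  proof (rule eq_vecI)
    fix k
    assume "k < dim_vec (Matrix.vec (N - 4) (fstar f))"
    then have k: "k < N - 4" "k \<le> N - 5"
      by auto
    then have "vec_index (?M *\<^sub>v Matrix.vec (N - 4) a) k = (\<Sum>j = 0..<N - 4.
        (b2 k j + \<alpha>\<^sub>2 * g4 k j + \<beta>\<^sub>2 * g3 k j + \<gamma>\<^sub>2 * g2 k j + \<delta>\<^sub>2 * g1 k j + \<mu>\<^sub>2 * g0 k j) * a j)"
      by (simp add: sqmat_def scalar_prod_def add.assoc)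
    also have "\<dots> = fstar f k"
      unfolding idx using galerkin_row[OF assms(4)[unfolded assms(3)] k(2)] .
    finally show "vec_index (?M *\<^sub>v Matrix.vec (N - 4) a) k = vec_index (Matrix.vec (N - 4) (fstar f)) k"
      using k by simp
  qed (simp add: sqmat_def)
qed (simp add: b2_neq_0_iff g4_neq_0_iff g3_neq_0_iff g2_neq_0_iff g1_neq_0_iff g0_neq_0_iff)

end
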